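(* Let $X$ be a countably infinite set, $\mathcal{F}$ a non-principal ultrafilter on $X$, and $\mathcal{I}$ the ideal of $\mathcal{F}$. Then the maximal subsemigroups of $I_X$ which contain $\operatorname{Sym}(X)_{\{\mathcal{F}\}}$ but not $\operatorname{Sym}(X)$ are exactly the following two: $$V_{\mathcal{F}} = \{ f \in I_X \mid \operatorname{dom}(f) \in \mathcal{I}, \text{ or } (\forall \Sigma \subseteq X)\ (\Sigma f \in \mathcal{F} \Leftrightarrow \Sigma \in \mathcal{F}) \},$$ $$V_{\mathcal{F}}^{-1} = \{ f \in I_X \mid \operatorname{im}(f) \in \mathcal{I}, \text{ or } (\forall \Sigma \subseteq X)\ (\Sigma f \in \mathcal{F} \Leftrightarrow \Sigma \in \mathcal{F}) \}.$$
   Context: For a set $X$, $I_X$ is the symmetric inverse monoid: the set of all bijections between subsets of $X$ (partial bijections, called charts) under composition of partial functions, written left to right (the image of $x$ under $f$ is $xf$). For $\Sigma \subseteq X$, $\Sigma f = \{ xf \mid x \in \Sigma \cap \operatorname{dom}(f)\}$. $\operatorname{Sym}(X) \subseteq I_X$ is the group of all permutations of $X$. The ideal of a filter $\mathcal{F}$ on $X$ is $\mathcal{I} = \{ \Sigma \subseteq X \mid X \setminus \Sigma \in \mathcal{F} \}$. The stabiliser of $\mathcal{F}$ is $\operatorname{Sym}(X)_{\{\mathcal{F}\}} = \{ f \in \operatorname{Sym}(X) \mid (\forall \Sigma \subseteq X)\ (\Sigma f \in \mathcal{F} \Leftrightarrow \Sigma \in \mathcal{F}) \}$. A maximal subsemigroup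 of $I_X$ is a proper subsemigroup that is maximal under containment among the proper subsemigroups of $I_X$. *)

theory Defs
  imports "HOL-Library.Countable_Set"
begin

text \<open>
  Partial functions on \<open>X\<close> are modelled by the maps \<open>'a \<rightharpoonup> 'a\<close> of \<^theory>\<open>HOL.Map\<close>, so that
  \<open>None\<close> means ``undefined'', and \<^term>\<open>dom f\<close> and \<^term>\<open>ran f\<close> are the domain and the image
  of a chart \<open>f\<close>.
\<close>

definition sym_inv_monoid :: "'a set \<Rightarrow> ('a \<rightharpoonup> 'a) set" where
  "sym_inv_monoid X = {f. dom f \<subseteq> X \<and> ran f \<subseteq> X \<and> inj_on f (dom f)}"

text \<open>Charts compose from left to right: first \<open>f\<close>, then \<open>g\<close>.\<close>

definition chart_comp :: "('a \<rightharpoonup> 'a) \<Rightarrow> ('a \<rightharpoonup> 'a) \<Rightarrow> ('a \<rightharpoonup> 'a)" where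
  "chart_comp f g = g \<circ>\<^sub>m f"

definition chart_image :: "('a \<rightharpoonup> 'a) \<Rightarrow> 'a set \<Rightarrow> 'a set" where
  "chart_image f \<Sigma> = {the (f x) | x. x \<in> \<Sigma> \<inter> dom f}"

definition sym_group_on :: "'a set \<Rightarrow> ('a \<rightharpoonup> 'a) set" where
  "sym_group_on X = {f \<in> sym_inv_monoid X. dom f = X \<and> ran f = X}"

definition subsemigroup_on :: "'a set \<Rightarrow> ('a \<rightharpoonup> 'a) set \<Rightarrow> bool" where
  "subsemigroup_on X M \<longleftrightarrow>
     M \<subseteq> sym_inv_monoid X \<and> (\<forall>f\<in>M. \<forall>g\<in>M. chart_comp f g \<in> M)"

definition maximal_subsemigroup_on :: "'a set \<Rightarrow> ('a \<rightharpoonup> 'a) set \<Rightarrow> bool" where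
  "maximal_subsemigroup_on X M \<longleftrightarrow>
     subsemigroup_on X M \<and> M \<noteq> sym_inv_monoid X \<and>
     (\<forall>N. subsemigroup_on X N \<and> N \<noteq> sym_inv_monoid X \<and> M \<subseteq> N \<longrightarrow> N = M)"

text \<open>
  The library type \<open>'a filter\<close> consists of filters on a whole type, including the improper one;
  here a filter on the set \<open>X\<close> is a family of subsets of \<open>X\<close>, and it is proper.
\<close>

definition filter_on :: "'a set \<Rightarrow> 'a set set \<Rightarrow> bool" where
  "filter_on X F \<longleftrightarrow>
     F \<subseteq> Pow X \<and> X \<in> F \<and> {} \<notin> F \<and>
     (\<forall>A\<in>F. \<forall>B\<in>F. A \<inter> B \<in> F) \<and>
     (\<forall>A\<in>F. \<forall>B. A \<subseteq> B \<and> B \<subseteq> X \<longrightarrow> B \<in> F)"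

definition ultrafilter_on :: "'a set \<Rightarrow> 'a set set \<Rightarrow> bool" where
  "ultrafilter_on X F \<longleftrightarrow>
     filter_on X F \<and> (\<forall>G. filter_on X G \<and> F \<subseteq> G \<longrightarrow> G = F)"

definition principal_ultrafilter_on :: "'a set \<Rightarrow> 'a set set \<Rightarrow> bool" where
  "principal_ultrafilter_on X F \<longleftrightarrow> (\<exists>x\<in>X. F = {A. A \<subseteq> X \<and> x \<in> A})"

definition filter_ideal :: "'a set \<Rightarrow> 'a set set \<Rightarrow> 'a set set" where
  "filter_ideal X F = {\<Sigma>. \<Sigma> \<subseteq> X \<and> X - \<Sigma> \<in> F}"

definition preserves_filter :: "'a set \<Rightarrow> 'a set set \<Rightarrow> ('a \<rightharpoonup> 'a) \<Rightarrow> bool" where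
  "preserves_filter X F f \<longleftrightarrow> (\<forall>\<Sigma>. \<Sigma> \<subseteq> X \<longrightarrow> (chart_image f \<Sigma> \<in> F \<longleftrightarrow> \<Sigma> \<in> F))"

definition filter_stabiliser :: "'a set \<Rightarrow> 'a set set \<Rightarrow> ('a \<rightharpoonup> 'a) set" where
  "filter_stabiliser X F = {f \<in> sym_group_on X. preserves_filter X F f}"

definition V_dom :: "'a set \<Rightarrow> 'a set set \<Rightarrow> ('a \<rightharpoonup> 'a) set" where
  "V_dom X F = {f \<in> sym_inv_monoid X. dom f \<in> filter_ideal X F \<or> preserves_filter X F f}"

text \<open>This is the set written \<open>V\<^sub>F\<close> with exponent \<open>-1\<close>.\<close>

definition V_im :: "'a set \<Rightarrow> 'a set set \<Rightarrow> ('a \<rightharpoonup> 'a) set" where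
  "V_im X F = {f \<in> sym_inv_monoid X. ran f \<in> filter_ideal X F \<or> preserves_filter X F f}"

end

(*
  Inversion of charts exchanges V_dom and V_im, so half of each claim suffices. The basic tool is
  that every bijection between two sets outside F extends to a permutation stabilising F, since F
  contains a set disjoint from both, with infinite complement, that can be fixed pointwise.
  A maximal subsemigroup M that omits some permutation lies in no proper subsemigroup containing
  all permutations; this yields total charts in M that miss infinitely many points. Together with
  an element of M outside V_dom they give a total chart p in M whose image is outside F. Dually, if M
  is not inside V_im, it contains a surjective chart q whose domain is outside F. Every permutation
  is then a product p s q with s stabilising F, a contradiction.
*)
theory Submission
  imports Defs
begin

section \<open>Charts\<close>

lemma map_eqI: "(\<And>x y. f x = Some y \<longleftrightarrow> g x = Some y) \<Longrightarrow> f = g"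
  by (rule ext) (metis option.exhaust)

lemma chart_comp_eq_Some:
  "chart_comp f g x = Some z \<longleftrightarrow> (\<exists>y. f x = Some y \<and> g y = Some z)"
  by (auto simp: chart_comp_def map_comp_Some_iff)

lemma mem_chart_image: "y \<in> chart_image f A \<longleftrightarrow> (\<exists>x\<in>A. f x = Some y)"
  unfolding chart_image_def by force

lemma chart_image_comp: "chart_image (chart_comp f g) A = chart_image g (chart_image f A)"
  unfolding set_eq_iff mem_chart_image chart_comp_eq_Some Bex_def by blast

lemma ran_chart_comp: "ran (chart_comp f g) = chart_image g (ran f)"
  unfolding set_eq_iff mem_chart_image ran_def chart_comp_eq_Some by blast

lemma chart_image_mono: "A \<subseteq> B \<Longrightarrow> chart_image f A \<subseteq> chart_image f B"
  unfolding chart_image_def by blast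

lemma chart_image_eq_image: "A \<subseteq> dom f \<Longrightarrow> chart_image f A = (the \<circ> f) ` A"
  unfolding chart_image_def by force

lemma sym_inv_monoid_iff:
  "f \<in> sym_inv_monoid X \<longleftrightarrow>
     (\<forall>x y. f x = Some y \<longrightarrow> x \<in> X \<and> y \<in> X) \<and>
     (\<forall>x x' y. f x = Some y \<longrightarrow> f x' = Some y \<longrightarrow> x = x')"
  unfolding sym_inv_monoid_def inj_on_def dom_def ran_def
  by (auto; metis)

lemma chart_in: "f \<in> sym_inv_monoid X \<Longrightarrow> f x = Some y \<Longrightarrow> x \<in> X \<and> y \<in> X"
  unfolding sym_inv_monoid_iff by blast

lemma chart_inj: "f \<in> sym_inv_monoid X \<Longrightarrow> f x = Some y \<Longrightarrow> f x' = Some y \<Longrightarrow> x = x'"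
  unfolding sym_inv_monoid_iff by blast

lemma dom_subset_carrier: "f \<in> sym_inv_monoid X \<Longrightarrow> dom f \<subseteq> X"
  and ran_subset_carrier: "f \<in> sym_inv_monoid X \<Longrightarrow> ran f \<subseteq> X"
  unfolding sym_inv_monoid_def by auto

lemma total_value: "dom f = X \<Longrightarrow> x \<in> X \<Longrightarrow> \<exists>y. f x = Some y"
  by blast

lemma chart_comp_closed:
  "f \<in> sym_inv_monoid X \<Longrightarrow> g \<in> sym_inv_monoid X \<Longrightarrow> chart_comp f g \<in> sym_inv_monoid X"
  unfolding sym_inv_monoid_iff by (simp add: chart_comp_eq_Some) metis

lemma subsemigroup_comp:
  "subsemigroup_on X M \<Longrightarrow> f \<in> M \<Longrightarrow> g \<in> M \<Longrightarrow> chart_comp f g \<in> M"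
  unfolding subsemigroup_on_def by blast

lemma subsemigroup_chart: "subsemigroup_on X M \<Longrightarrow> f \<in> M \<Longrightarrow> f \<in> sym_inv_monoid X"
  unfolding subsemigroup_on_def by blast

lemma finite_chart_image: "finite A \<Longrightarrow> finite (chart_image f A)"
  by (rule finite_subset[of _ "(the \<circ> f) ` A"]) (force simp: mem_chart_image)+

lemma bij_betw_chart:
  assumes "f \<in> sym_inv_monoid X" "dom f = D"
  shows "bij_betw (the \<circ> f) D (ran f)"
proof (rule bij_betwI')
  show "(the \<circ> f) x = (the \<circ> f) y \<longleftrightarrow> x = y" if "x \<in> D" "y \<in> D" for x y
    using assms that chart_inj[OF assms(1)] by force
  show "(the \<circ> f) x \<in> ran f" if "x \<in> D" for x
    using assms that by (force intro: ranI)
  show "\<exists>x\<in>D. y = (the \<circ> f) x" if "y \<in> ran f" for y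
    using assms that by (force simp: ran_def)
qed

section \<open>Charts given by a function on a domain\<close>

definition chart_of :: "'a set \<Rightarrow> ('a \<Rightarrow> 'a) \<Rightarrow> ('a \<rightharpoonup> 'a)" where
  "chart_of D h = (\<lambda>x. if x \<in> D then Some (h x) else None)"

lemma chart_of_eq_Some: "chart_of D h x = Some y \<longleftrightarrow> x \<in> D \<and> y = h x"
  by (auto simp: chart_of_def)

lemma dom_chart_of: "dom (chart_of D h) = D"
  and ran_chart_of: "ran (chart_of D h) = h ` D"
  by (auto simp: dom_def ran_def chart_of_eq_Some)

lemma chart_image_chart_of: "A \<subseteq> D \<Longrightarrow> chart_image (chart_of D h) A = h ` A"
  unfolding set_eq_iff mem_chart_image chart_of_eq_Some image_iff by blast

lemma chart_of_chart:
  "D \<subseteq> X \<Longrightarrow> inj_on h D \<Longrightarrow> h ` D \<subseteq> X \<Longrightarrow> chart_of D h \<in> sym_inv_monoid X"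
  unfolding sym_inv_monoid_iff by (auto simp: chart_of_eq_Some inj_on_def)

lemma chart_of_sym: "bij_betw h X X \<Longrightarrow> chart_of X h \<in> sym_group_on X"
  unfolding sym_group_on_def
  by (auto simp: bij_betw_def dom_chart_of ran_chart_of intro: chart_of_chart)

section \<open>Inversion of charts\<close>

text \<open>For a chart, injectivity forces the choice, so this is the inverse in the inverse
  monoid.\<close>

definition chart_inv :: "('a \<rightharpoonup> 'a) \<Rightarrow> ('a \<rightharpoonup> 'a)" where
  "chart_inv f = (\<lambda>y. if y \<in> ran f then Some (SOME x. f x = Some y) else None)"

lemma chart_inv_eq_Some:
  assumes "f \<in> sym_inv_monoid X"
  shows "chart_inv f y = Some x \<longleftrightarrow> f x = Some y"
proof
  assume "chart_inv f y = Some x"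
  then have "y \<in> ran f" and x: "x = (SOME x. f x = Some y)"
    by (auto simp: chart_inv_def split: if_splits)
  then have "\<exists>x. f x = Some y" by (simp add: ran_def)
  then show "f x = Some y" unfolding x by (rule someI_ex)
next
  assume *: "f x = Some y"
  then have "(SOME x. f x = Some y) = x"
    using chart_inj[OF assms] by (intro some_equality) auto
  with * show "chart_inv f y = Some x" by (auto simp: chart_inv_def ran_def)
qed

lemma chart_inv_chart: "f \<in> sym_inv_monoid X \<Longrightarrow> chart_inv f \<in> sym_inv_monoid X"
  using chart_inv_eq_Some[of f X] unfolding sym_inv_monoid_iff[of "chart_inv f"]
  by (metis chart_in option.inject)

lemma chart_inv_inv: "f \<in> sym_inv_monoid X \<Longrightarrow> chart_inv (chart_inv f) = f"
  by (rule map_eqI) (simp add: chart_inv_eq_Some chart_inv_chart chart_inv_eq_Some[OF chart_inv_chart])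

lemma chart_inv_comp:
  assumes "f \<in> sym_inv_monoid X" "g \<in> sym_inv_monoid X"
  shows "chart_inv (chart_comp f g) = chart_comp (chart_inv g) (chart_inv f)"
  by (rule map_eqI)
     (auto simp: chart_inv_eq_Some[OF assms(1)] chart_inv_eq_Some[OF assms(2)]
       chart_inv_eq_Some[OF chart_comp_closed[OF assms]] chart_comp_eq_Some)

lemma dom_chart_inv: "f \<in> sym_inv_monoid X \<Longrightarrow> dom (chart_inv f) = ran f"
  and ran_chart_inv: "f \<in> sym_inv_monoid X \<Longrightarrow> ran (chart_inv f) = dom f"
  by (auto simp: dom_def ran_def chart_inv_eq_Some)

lemma chart_inv_image_image: "M \<subseteq> sym_inv_monoid X \<Longrightarrow> chart_inv ` chart_inv ` M = M"
  using chart_inv_inv by (force simp: image_image)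

text \<open>An involution mapping a set into itself maps it onto itself. This serves the monoid, the
  symmetric group and the stabiliser alike.\<close>

lemma chart_inv_image_eq:
  assumes "M \<subseteq> sym_inv_monoid X" "\<And>f. f \<in> M \<Longrightarrow> chart_inv f \<in> M"
  shows "chart_inv ` M = M"
proof
  show "chart_inv ` M \<subseteq> M" using assms(2) by blast
  then have "chart_inv ` chart_inv ` M \<subseteq> chart_inv ` M" by (rule image_mono)
  then show "M \<subseteq> chart_inv ` M" unfolding chart_inv_image_image[OF assms(1)] .
qed

lemma chart_inv_monoid: "chart_inv ` sym_inv_monoid X = sym_inv_monoid X"
  by (rule chart_inv_image_eq[OF subset_refl chart_inv_chart])

lemma chart_inv_sym: "chart_inv ` sym_group_on X = sym_group_on X"
proof (rule chart_inv_image_eq)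
  show "sym_group_on X \<subseteq> sym_inv_monoid X" by (auto simp: sym_group_on_def)
  show "chart_inv f \<in> sym_group_on X" if "f \<in> sym_group_on X" for f
    using that dom_chart_inv[of f X] ran_chart_inv[of f X] chart_inv_chart[of f X]
    by (simp add: sym_group_on_def)
qed

lemma subsemigroup_inv: "subsemigroup_on X M \<Longrightarrow> subsemigroup_on X (chart_inv ` M)"
  unfolding subsemigroup_on_def
  by (auto simp: chart_inv_chart subset_iff chart_inv_comp[of _ X, symmetric])

text \<open>Inversion is an involutive anti-automorphism, so it acts on proper subsemigroups as an
  inclusion-preserving involution. This is the duality that halves the later work.\<close>

lemma maximal_inv:
  assumes "maximal_subsemigroup_on X M"
  shows "maximal_subsemigroup_on X (chart_inv ` M)"
proof -
  have M: "subsemigroup_on X M" "M \<subseteq> sym_inv_monoid X" "M \<noteq> sym_inv_monoid X"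
    and max: "\<And>N. subsemigroup_on X N \<Longrightarrow> N \<noteq> sym_inv_monoid X \<Longrightarrow> M \<subseteq> N \<Longrightarrow> N = M"
    using assms by (auto simp: maximal_subsemigroup_on_def subsemigroup_on_def)
  have proper: "chart_inv ` N \<noteq> sym_inv_monoid X"
    if "N \<subseteq> sym_inv_monoid X" "N \<noteq> sym_inv_monoid X" for N
    using that chart_inv_image_image[of N X] chart_inv_monoid[of X] by metis
  have "N = chart_inv ` M"
    if N: "subsemigroup_on X N" "N \<noteq> sym_inv_monoid X" "chart_inv ` M \<subseteq> N" for N
  proof -
    have NI: "N \<subseteq> sym_inv_monoid X" using N(1) by (simp add: subsemigroup_on_def)
    have "M \<subseteq> chart_inv ` N"
      using image_mono[OF N(3), of chart_inv] chart_inv_image_image[OF M(2)] by simp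
    then have "chart_inv ` N = M"
      using max subsemigroup_inv[OF N(1)] proper[OF NI N(2)] by blast
    then show ?thesis using chart_inv_image_image[OF NI] by metis
  qed
  then show ?thesis
    unfolding maximal_subsemigroup_on_def
    using subsemigroup_inv[OF M(1)] proper[OF M(2,3)] by blast
qed

section \<open>Semigroups defined by the size of the defect\<close>

text \<open>\<open>J\<close> is a notion of small set. For \<open>J = {{}}\<close> the condition
  says that a total chart is surjective; for the finite sets, that a cofinite domain forces a
  cofinite image.\<close>

definition defect_semigroup :: "'a set \<Rightarrow> 'a set set \<Rightarrow> ('a \<rightharpoonup> 'a) set" where
  "defect_semigroup X J = {f \<in> sym_inv_monoid X. X - dom f \<in> J \<longrightarrow> X - ran f \<in> J}"

text \<open>If the product is undefined only on a small set, smallness passes in turn to the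
  complements of \<open>dom f\<close>, \<open>ran f\<close>, \<open>dom g\<close>,
  \<open>ran g\<close> and finally of the image of the product.\<close>

lemma subsemigroup_defect:
  assumes sub: "\<And>A B. A \<in> J \<Longrightarrow> B \<subseteq> A \<Longrightarrow> B \<in> J"
    and un: "\<And>A B. A \<in> J \<Longrightarrow> B \<in> J \<Longrightarrow> A \<union> B \<in> J"
    and im: "\<And>A f. A \<in> J \<Longrightarrow> chart_image f A \<in> J"
  shows "subsemigroup_on X (defect_semigroup X J)"
  unfolding subsemigroup_on_def
proof (intro conjI ballI)
  fix f g assume f: "f \<in> defect_semigroup X J" and g: "g \<in> defect_semigroup X J"
  let ?h = "chart_comp f g"
  have fI: "f \<in> sym_inv_monoid X" and gI: "g \<in> sym_inv_monoid X"
    using f g by (auto simp: defect_semigroup_def)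
  have "X - ran ?h \<in> J" if h: "X - dom ?h \<in> J"
  proof -
    have "X - dom f \<subseteq> X - dom ?h" by (auto simp: dom_def chart_comp_eq_Some)
    then have rf: "X - ran f \<in> J" using f h sub by (auto simp: defect_semigroup_def)
    \<comment> \<open>A point hit by \<open>f\<close> but outside \<open>dom g\<close> comes from a
      point where the product is undefined.\<close>
    have "X - dom g \<subseteq> (X - ran f) \<union> chart_image f (X - dom ?h)"
    proof
      fix y assume y: "y \<in> X - dom g"
      show "y \<in> (X - ran f) \<union> chart_image f (X - dom ?h)"
      proof (cases "y \<in> ran f")
        case True
        then obtain x where x: "f x = Some y" by (auto simp: ran_def)
        then have "?h x = None" using y by (auto simp: chart_comp_def map_comp_def)
        then have "x \<in> X - dom ?h" using chart_in[OF fI x] by blast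
        then show ?thesis using x by (auto simp: mem_chart_image)
      qed (use y in blast)
    qed
    then have "X - dom g \<in> J" using sub un[OF rf im[OF h]] by blast
    then have rg: "X - ran g \<in> J" using g by (auto simp: defect_semigroup_def)
    \<comment> \<open>A point hit by \<open>g\<close> but missed by the product comes from a point
      missed by \<open>f\<close>.\<close>
    have "X - ran ?h \<subseteq> (X - ran g) \<union> chart_image g (X - ran f)"
    proof
      fix z assume z: "z \<in> X - ran ?h"
      show "z \<in> (X - ran g) \<union> chart_image g (X - ran f)"
      proof (cases "z \<in> ran g")
        case True
        then obtain y where y: "g y = Some z" by (auto simp: ran_def)
        have "y \<notin> ran f"
        proof
          assume "y \<in> ran f"
          then obtain x where "f x = Some y" by (auto simp: ran_def)
          then have "?h x = Some z" using y by (auto simp: chart_comp_eq_Some)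
          then show False using z by (auto simp: ran_def)
        qed
        then have "y \<in> X - ran f" using chart_in[OF gI y] by blast
        then show ?thesis using y by (auto simp: mem_chart_image)
      qed (use z in blast)
    qed
    then show ?thesis using sub un[OF rg im[OF rf]] by blast
  qed
  then show "?h \<in> defect_semigroup X J"
    using chart_comp_closed[OF fI gI] by (auto simp: defect_semigroup_def)
qed (auto simp: defect_semigroup_def)

text \<open>Along an enumeration \<open>e\<close> of \<open>X\<close>, send \<open>e n\<close> to
  \<open>e (2 * n)\<close>; the points with odd index are missed.\<close>

lemma ex_total_coinfinite_chart:
  assumes "countable X" "infinite X"
  obtains p where "p \<in> sym_inv_monoid X" "dom p = X" "infinite (X - ran p)"
proof -
  obtain e :: "nat \<Rightarrow> 'a" where e: "bij_betw e UNIV X"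
    using assms by (metis bij_betw_from_nat_into)
  let ?h = "\<lambda>x. e (2 * inv_into UNIV e x)"
  have e': "bij_betw (inv_into UNIV e) X UNIV" using e by (rule bij_betw_inv_into)
  have eq: "e m = e n \<longleftrightarrow> m = n" for m n
    using e by (simp add: bij_betw_def inj_eq)
  have inj: "inj_on ?h X"
    using bij_betw_imp_inj_on[OF e'] by (simp add: inj_on_def eq)
  have "range (\<lambda>n. e (2 * n + 1)) \<subseteq> X - ?h ` X"
  proof
    fix y assume "y \<in> range (\<lambda>n. e (2 * n + 1))"
    then obtain n where y: "y = e (2 * n + 1)" by blast
    have "y \<noteq> ?h x" for x
      unfolding y eq by presburger
    then show "y \<in> X - ?h ` X" using bij_betwE[OF e] y by blast
  qed
  moreover have "infinite (range (\<lambda>n. e (2 * n + 1)))"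
    by (rule range_inj_infinite) (simp add: inj_def eq)
  ultimately have "infinite (X - ?h ` X)" using finite_subset by blast
  moreover have "?h ` X \<subseteq> X" using bij_betwE[OF e] by blast
  ultimately show ?thesis
    using that[of "chart_of X ?h"] inj by (simp add: chart_of_chart dom_chart_of ran_chart_of)
qed

text \<open>The defect semigroup contains every permutation but no total chart with infinitely many
  missed points, so it is proper. Were \<open>M\<close> inside it, maximality would make them equal
  and \<open>M\<close> would contain all permutations.\<close>

lemma maximal_not_within_defect:
  assumes "maximal_subsemigroup_on X M" "\<not> sym_group_on X \<subseteq> M"
    and "subsemigroup_on X (defect_semigroup X J)"
    and "{} \<in> J" "\<And>A. A \<in> J \<Longrightarrow> finite A"
    and "countable X" "infinite X"
  obtains f where "f \<in> M" "X - dom f \<in> J" "X - ran f \<notin> J"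
proof -
  obtain p where "p \<in> sym_inv_monoid X" "dom p = X" "infinite (X - ran p)"
    using ex_total_coinfinite_chart assms(6,7) by blast
  then have "p \<in> sym_inv_monoid X - defect_semigroup X J"
    using assms(4,5) by (auto simp: defect_semigroup_def)
  moreover have "sym_group_on X \<subseteq> defect_semigroup X J"
    using assms(4) by (auto simp: sym_group_on_def defect_semigroup_def)
  ultimately have "\<not> M \<subseteq> defect_semigroup X J"
    using assms(1,2,3) unfolding maximal_subsemigroup_on_def by blast
  moreover have "M \<subseteq> sym_inv_monoid X"
    using assms(1) by (auto simp: maximal_subsemigroup_on_def subsemigroup_on_def)
  ultimately show ?thesis using that by (auto simp: defect_semigroup_def)
qed

section \<open>Ultrafilters\<close>

locale nonprincipal_ultrafilter =
  fixes X :: "'a set" and F :: "'a set set"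
  assumes count: "countable X" and inf: "infinite X"
    and ultra: "ultrafilter_on X F" and nonprincipal: "\<not> principal_ultrafilter_on X F"
begin

lemma is_filter: "filter_on X F"
  using ultra by (simp add: ultrafilter_on_def)

lemma carrier: "X \<in> F"
  and empty_notin: "{} \<notin> F"
  and subset_carrier: "A \<in> F \<Longrightarrow> A \<subseteq> X"
  and inter: "A \<in> F \<Longrightarrow> B \<in> F \<Longrightarrow> A \<inter> B \<in> F"
  and upward: "A \<in> F \<Longrightarrow> A \<subseteq> B \<Longrightarrow> B \<subseteq> X \<Longrightarrow> B \<in> F"
  using is_filter unfolding filter_on_def by blast+

lemma Diff_mem_iff:
  assumes A: "A \<subseteq> X"
  shows "X - A \<in> F \<longleftrightarrow> A \<notin> F"
proof
  show "A \<notin> F" if "X - A \<in> F"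
  proof
    assume "A \<in> F"
    then have "(X - A) \<inter> A \<in> F" by (rule inter[OF that])
    moreover have "(X - A) \<inter> A = {}" by blast
    ultimately show False using empty_notin by simp
  qed
next
  assume nA: "A \<notin> F"
  show "X - A \<in> F"
  proof (rule ccontr)
    assume n: "X - A \<notin> F"
    \<comment> \<open>The filter generated by \<open>F\<close> and \<open>A\<close>. It is proper
      since no member of \<open>F\<close> lies inside \<open>X - A\<close>; maximality of
      \<open>F\<close> then puts \<open>A\<close> into \<open>F\<close>.\<close>
    define G where "G = {B. B \<subseteq> X \<and> (\<exists>C\<in>F. C \<inter> A \<subseteq> B)}"
    have "filter_on X G"
      unfolding filter_on_def
    proof (intro conjI ballI allI impI)
      show "G \<subseteq> Pow X" and "X \<in> G" using carrier A by (auto simp: G_def)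
      show "{} \<notin> G"
      proof
        assume "{} \<in> G"
        then obtain C where "C \<in> F" "C \<inter> A \<subseteq> {}" by (auto simp: G_def)
        then show False using n upward[of C "X - A"] subset_carrier[of C] by blast
      qed
      show "B \<inter> B' \<in> G" if B: "B \<in> G" "B' \<in> G" for B B'
      proof -
        obtain C C' where "C \<in> F" "C \<inter> A \<subseteq> B" "C' \<in> F" "C' \<inter> A \<subseteq> B'"
          using B by (auto simp: G_def)
        then have "C \<inter> C' \<in> F" "C \<inter> C' \<inter> A \<subseteq> B \<inter> B'" using inter by blast+
        then show ?thesis using B by (auto simp: G_def)
      qed
      show "B' \<in> G" if "B \<in> G" "B \<subseteq> B' \<and> B' \<subseteq> X" for B B'
        using that unfolding G_def by blast
    qed
    moreover have "F \<subseteq> G" using subset_carrier by (auto simp: G_def)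
    ultimately have "G = F" using ultra by (simp add: ultrafilter_on_def)
    moreover have "A \<in> G" using A carrier by (auto simp: G_def)
    ultimately show False using nA by simp
  qed
qed

lemma ideal_iff: "A \<in> filter_ideal X F \<longleftrightarrow> A \<subseteq> X \<and> A \<notin> F"
  using Diff_mem_iff by (auto simp: filter_ideal_def)

lemma Un_mem_iff: "A \<subseteq> X \<Longrightarrow> B \<subseteq> X \<Longrightarrow> A \<union> B \<in> F \<longleftrightarrow> A \<in> F \<or> B \<in> F"
proof -
  assume AB: "A \<subseteq> X" "B \<subseteq> X"
  have "A \<in> F \<or> B \<in> F" if "A \<union> B \<in> F"
  proof (rule ccontr)
    assume "\<not> (A \<in> F \<or> B \<in> F)"
    then have "(X - A) \<inter> (X - B) \<in> F" using AB Diff_mem_iff inter by blast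
    then have "X - (A \<union> B) \<in> F" by (simp add: Diff_Un)
    then show False using that AB Diff_mem_iff[of "A \<union> B"] by blast
  qed
  then show ?thesis using AB upward by (metis Un_upper1 Un_upper2 le_sup_iff)
qed

lemma finite_notin: "finite A \<Longrightarrow> A \<subseteq> X \<Longrightarrow> A \<notin> F"
proof (induction A rule: finite_induct)
  case empty
  then show ?case using empty_notin by simp
next
  case (insert x A)
  \<comment> \<open>A singleton in \<open>F\<close> meets every member of \<open>F\<close>, which
    would make \<open>F\<close> principal.\<close>
  have "{x} \<notin> F"
  proof
    assume x: "{x} \<in> F"
    have 1: "x \<in> A" if "A \<in> F" for A
    proof (rule ccontr)
      assume "x \<notin> A"
      then have "{x} \<inter> A = {}" by blast
      then show False using inter[OF x that] empty_notin by simp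
    qed
    have 2: "A \<in> F" if "x \<in> A" "A \<subseteq> X" for A using upward[OF x, of A] that by auto
    have "F = {A. A \<subseteq> X \<and> x \<in> A}"
      by (rule set_eqI, rule iffI) (simp_all add: 1 2 subset_carrier)
    moreover have "x \<in> X" using insert.prems by simp
    ultimately have "principal_ultrafilter_on X F"
      unfolding principal_ultrafilter_on_def by (rule bexI)
    then show False using nonprincipal by contradiction
  qed
  moreover have "A \<notin> F" "{x} \<subseteq> X" "A \<subseteq> X" using insert by auto
  ultimately have "{x} \<union> A \<notin> F" by (simp add: Un_mem_iff del: insert_subset Un_insert_left)
  then show ?case by simp
qed

lemma infinite_mem: "A \<in> F \<Longrightarrow> infinite A"
  using finite_notin[of A] subset_carrier[of A] by blast

text \<open>A coinfinite image of an injection of \<open>A\<close> into itself cuts \<open>A\<close>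
  into two infinite halves, one of which lies in \<open>F\<close>. The other half is spare room for
  rearranging points while a member of \<open>F\<close> stays fixed.\<close>

lemma split_mem:
  assumes "A \<in> F"
  obtains B where "B \<in> F" "B \<subseteq> A" "infinite (A - B)"
proof -
  have AX: "A \<subseteq> X" by (rule subset_carrier[OF assms])
  have infA: "infinite A" by (rule infinite_mem[OF assms])
  obtain p where p: "p \<in> sym_inv_monoid A" "dom p = A" "infinite (A - ran p)"
    using ex_total_coinfinite_chart[OF countable_subset[OF AX count] infA] .
  have r: "ran p \<subseteq> A" using p(1) by (rule ran_subset_carrier)
  have "infinite (ran p)"
    using bij_betw_finite[OF bij_betw_chart[OF p(1,2)]] infA by simp
  then have inf': "infinite (A - (A - ran p))" using r by (simp add: double_diff)
  have "ran p \<union> (A - ran p) = A" using r by blast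
  then have "ran p \<in> F \<or> A - ran p \<in> F"
    using Un_mem_iff[of "ran p" "A - ran p"] assms r AX by auto
  then show ?thesis
  proof
    assume "ran p \<in> F"
    then show ?thesis using r p(3) by (rule that)
  next
    assume "A - ran p \<in> F"
    then show ?thesis using Diff_subset inf' by (rule that)
  qed
qed

lemma ex_bij_betw_infinite:
  assumes "A \<subseteq> X" "infinite A" "B \<subseteq> X" "infinite B"
  obtains h where "bij_betw h A B"
proof -
  have "countable A" "countable B" using assms(1,3) count countable_subset by auto
  then have "bij_betw (from_nat_into B \<circ> to_nat_on A) A B"
    using assms(2,4) by (intro bij_betw_trans[OF to_nat_on_infinite bij_betw_from_nat_into])
  then show ?thesis by (rule that)
qed

section \<open>Charts that preserve the ultrafilter\<close>

lemma preserves_comp: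
  assumes "f \<in> sym_inv_monoid X" "preserves_filter X F f" "preserves_filter X F g"
  shows "preserves_filter X F (chart_comp f g)"
proof -
  have "chart_image f A \<subseteq> X" for A
    using chart_in[OF assms(1)] by (auto simp: mem_chart_image)
  then show ?thesis
    using assms by (simp add: preserves_filter_def chart_image_comp)
qed

text \<open>Both \<open>X\<close> and \<open>dom f\<close> have image \<open>ran f\<close>, so
  membership of \<open>X\<close> in \<open>F\<close> passes to \<open>ran f\<close> and back to
  \<open>dom f\<close>.\<close>

lemma preserves_dom:
  assumes "f \<in> sym_inv_monoid X" "preserves_filter X F f"
  shows "dom f \<in> F" and "ran f \<in> F"
proof -
  have "chart_image f (dom f) = ran f" "chart_image f X = ran f"
    using chart_in[OF assms(1)]
    unfolding set_eq_iff mem_chart_image ran_def Bex_def by auto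
  then show "ran f \<in> F" "dom f \<in> F"
    using assms carrier dom_subset_carrier[OF assms(1)] unfolding preserves_filter_def
    by (metis subset_refl)+
qed

text \<open>Applying \<open>f\<close> to the inverse image of \<open>A\<close> gives
  \<open>A \<inter> ran f\<close>, and intersecting with \<open>ran f\<close>, a member of
  \<open>F\<close>, does not affect membership in \<open>F\<close>.\<close>

lemma preserves_inv:
  assumes f: "f \<in> sym_inv_monoid X" "preserves_filter X F f"
  shows "preserves_filter X F (chart_inv f)"
  unfolding preserves_filter_def
proof (intro allI impI)
  fix A assume A: "A \<subseteq> X"
  have "chart_image (chart_inv f) A \<subseteq> X"
    using chart_in[OF f(1)] by (auto simp: mem_chart_image chart_inv_eq_Some[OF f(1)])
  then have "chart_image (chart_inv f) A \<in> F \<longleftrightarrow> chart_image f (chart_image (chart_inv f) A) \<in> F"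
    using f(2) by (simp add: preserves_filter_def)
  also have "chart_image f (chart_image (chart_inv f) A) = A \<inter> ran f"
    unfolding set_eq_iff mem_chart_image Bex_def chart_inv_eq_Some[OF f(1)]
    by (auto simp: ran_def)
  also have "A \<inter> ran f \<in> F \<longleftrightarrow> A \<in> F"
    using preserves_dom(2)[OF f] inter upward A by blast
  finally show "chart_image (chart_inv f) A \<in> F \<longleftrightarrow> A \<in> F" .
qed

text \<open>Failure to preserve \<open>F\<close> can always be seen on a member of \<open>F\<close>
  that becomes small, even if the given failure is a small set that becomes large.\<close>

lemma not_preserves_witness:
  assumes f: "f \<in> sym_inv_monoid X" and "dom f \<in> F" "\<not> preserves_filter X F f"
  obtains A where "A \<in> F" "A \<subseteq> dom f" "chart_image f A \<notin> F"
proof -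
  obtain A where A: "A \<subseteq> X" "(chart_image f A \<in> F) \<noteq> (A \<in> F)"
    using assms(3) by (auto simp: preserves_filter_def)
  show ?thesis
  proof (cases "A \<in> F")
    case True
    moreover have "chart_image f (A \<inter> dom f) = chart_image f A"
      unfolding set_eq_iff mem_chart_image Bex_def by auto
    ultimately show ?thesis using that[of "A \<inter> dom f"] A assms(2) inter by auto
  next
    case False
    \<comment> \<open>By injectivity the image of \<open>?B\<close> is disjoint from that of
      \<open>A\<close>, which is in \<open>F\<close>; hence it is not in \<open>F\<close>.\<close>
    let ?B = "(X - A) \<inter> dom f"
    have "chart_image f A \<inter> chart_image f ?B = {}"
      by (auto simp: mem_chart_image dest: chart_inj[OF f])
    then have "chart_image f ?B \<notin> F" using A(2) False inter empty_notin by metis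
    moreover have "?B \<in> F" using False A Diff_mem_iff assms(2) inter by blast
    ultimately show ?thesis using that by blast
  qed
qed

text \<open>By injectivity a set and its image agree on \<open>C\<close>, and membership in
  \<open>F\<close> is decided by the trace on \<open>C\<close>.\<close>

lemma preserves_if_id_on_mem:
  assumes f: "f \<in> sym_inv_monoid X" and C: "C \<in> F" "\<And>x. x \<in> C \<Longrightarrow> f x = Some x"
  shows "preserves_filter X F f"
  unfolding preserves_filter_def
proof (intro allI impI)
  fix A assume A: "A \<subseteq> X"
  have sub: "chart_image f A \<subseteq> X" using chart_in[OF f] by (auto simp: mem_chart_image)
  have "chart_image f A \<inter> C = A \<inter> C"
  proof (intro set_eqI iffI)
    fix y assume y: "y \<in> chart_image f A \<inter> C"
    then obtain x where x: "x \<in> A" "f x = Some y" by (auto simp: mem_chart_image)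
    then have "x = y" using C(2)[of y] y chart_inj[OF f x(2)] by blast
    then show "y \<in> A \<inter> C" using x y by blast
  next
    fix y assume "y \<in> A \<inter> C"
    then show "y \<in> chart_image f A \<inter> C" using C(2)[of y] by (auto simp: mem_chart_image)
  qed
  moreover have "B \<inter> C \<in> F \<longleftrightarrow> B \<in> F" if "B \<subseteq> X" for B
    using that C inter upward by blast
  ultimately show "chart_image f A \<in> F \<longleftrightarrow> A \<in> F" using A sub by metis
qed

lemma stabiliser_extend:
  assumes S: "S \<subseteq> X" "S \<notin> F" and T: "T \<subseteq> X" "T \<notin> F" and h: "bij_betw h S T"
  obtains s where "s \<in> filter_stabiliser X F" "\<And>x. x \<in> S \<Longrightarrow> s x = Some (h x)"
proof -
  have "X - (S \<union> T) \<in> F" using Un_mem_iff S T Diff_mem_iff by simp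
  then obtain C where C: "C \<in> F" "C \<subseteq> X - (S \<union> T)" "infinite (X - (S \<union> T) - C)"
    using split_mem by blast
  \<comment> \<open>The spare infinite set makes the two remainders equinumerous even when
    \<open>S\<close> and \<open>T\<close> cover very different parts of \<open>X\<close>.\<close>
  have "infinite (X - C - S)" "infinite (X - C - T)"
    by (rule infinite_super[OF _ C(3)]; blast)+
  then obtain k where k: "bij_betw k (X - C - S) (X - C - T)"
    using ex_bij_betw_infinite[of "X - C - S" "X - C - T"] by blast
  define g where "g = (\<lambda>x. if x \<in> C then x else if x \<in> S then h x else k x)"
  have 1: "bij_betw g C C" unfolding g_def by (simp add: bij_betw_def inj_on_def)
  have 2: "bij_betw g S T"
    using C(2) by (subst bij_betw_cong[of S g h]) (auto simp: g_def h)
  have 3: "bij_betw g (X - C - S) (X - C - T)"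
    by (subst bij_betw_cong[of _ g k]) (auto simp: g_def k)
  have "bij_betw g (C \<union> (S \<union> (X - C - S))) (C \<union> (T \<union> (X - C - T)))"
    using C(2) by (intro bij_betw_combine 1 2 3) auto
  moreover have "C \<union> (S \<union> (X - C - S)) = X" "C \<union> (T \<union> (X - C - T)) = X"
    using C(2) S T by auto
  ultimately have s: "chart_of X g \<in> sym_group_on X" by (simp add: chart_of_sym)
  moreover have "preserves_filter X F (chart_of X g)"
    using s C by (intro preserves_if_id_on_mem[of _ C])
      (auto simp: sym_group_on_def chart_of_def g_def)
  ultimately have "chart_of X g \<in> filter_stabiliser X F" by (simp add: filter_stabiliser_def)
  moreover have "chart_of X g x = Some (h x)" if "x \<in> S" for x
    using that C(2) S by (auto simp: chart_of_def g_def)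
  ultimately show ?thesis using that by blast
qed

text \<open>Fix pointwise some \<open>B\<close> in \<open>F\<close> with \<open>A - B\<close>
  infinite, and squeeze \<open>X - B\<close> bijectively onto \<open>A - B\<close>.\<close>

lemma preserving_total_into:
  assumes "A \<in> F"
  obtains v where "v \<in> sym_inv_monoid X" "preserves_filter X F v" "dom v = X" "ran v \<subseteq> A"
proof -
  have AX: "A \<subseteq> X" using assms by (rule subset_carrier)
  obtain B where B: "B \<in> F" "B \<subseteq> A" "infinite (A - B)" using split_mem[OF assms] by blast
  have "infinite (X - B)" by (rule infinite_super[OF _ B(3)]) (use AX in blast)
  then obtain k where k: "bij_betw k (X - B) (A - B)"
    using ex_bij_betw_infinite[of "X - B" "A - B"] AX B(3) by blast
  define g where "g = (\<lambda>x. if x \<in> B then x else k x)"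
  have 1: "bij_betw g B B" unfolding g_def by (simp add: bij_betw_def inj_on_def)
  have 2: "bij_betw g (X - B) (A - B)"
    by (subst bij_betw_cong[of _ g k]) (auto simp: g_def k)
  have "bij_betw g (B \<union> (X - B)) (B \<union> (A - B))"
    by (intro bij_betw_combine 1 2) auto
  moreover have "B \<union> (X - B) = X" "B \<union> (A - B) = A" using B AX by auto
  ultimately have g: "bij_betw g X A" by simp
  then have v: "chart_of X g \<in> sym_inv_monoid X"
    using AX by (intro chart_of_chart) (auto simp: bij_betw_def)
  moreover have "preserves_filter X F (chart_of X g)"
    using v B AX by (intro preserves_if_id_on_mem[of _ B]) (auto simp: chart_of_def g_def)
  ultimately show ?thesis
    using that g by (simp add: dom_chart_of ran_chart_of bij_betw_def)
qed

lemma stabiliser_subset_monoid: "filter_stabiliser X F \<subseteq> sym_inv_monoid X"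
  by (auto simp: filter_stabiliser_def sym_group_on_def)

lemma stabiliser_inv: "chart_inv ` filter_stabiliser X F = filter_stabiliser X F"
proof (rule chart_inv_image_eq[OF stabiliser_subset_monoid])
  fix f assume f: "f \<in> filter_stabiliser X F"
  have "f \<in> sym_group_on X" "f \<in> sym_inv_monoid X" "preserves_filter X F f"
    using f stabiliser_subset_monoid by (auto simp: filter_stabiliser_def)
  then show "chart_inv f \<in> filter_stabiliser X F"
    using chart_inv_sym[of X] preserves_inv[of f] by (auto simp: filter_stabiliser_def)
qed

section \<open>The semigroups \<open>V_dom\<close> and \<open>V_im\<close>\<close>

lemma V_im_eq_inv: "V_im X F = chart_inv ` V_dom X F"
proof -
  have 1: "chart_inv f \<in> V_im X F" if "f \<in> V_dom X F" for f
    using that preserves_inv by (auto simp: V_im_def V_dom_def chart_inv_chart ran_chart_inv)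
  have 2: "chart_inv f \<in> V_dom X F" if "f \<in> V_im X F" for f
    using that preserves_inv by (auto simp: V_im_def V_dom_def chart_inv_chart dom_chart_inv)
  have "V_im X F \<subseteq> sym_inv_monoid X" by (auto simp: V_im_def)
  then show ?thesis using 1 2 chart_inv_image_image[of "V_im X F" X] by blast
qed

text \<open>If \<open>f\<close> does not preserve \<open>F\<close>, its domain is already small. If
  \<open>f\<close> does but \<open>g\<close> does not, \<open>f\<close> carries the domain of the
  product into the small set \<open>dom g\<close>, so that domain is small too.\<close>

lemma subsemigroup_V_dom: "subsemigroup_on X (V_dom X F)"
  unfolding subsemigroup_on_def
proof (intro conjI ballI)
  fix f g assume f: "f \<in> V_dom X F" and g: "g \<in> V_dom X F"
  let ?h = "chart_comp f g"
  have fI: "f \<in> sym_inv_monoid X" and gI: "g \<in> sym_inv_monoid X"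
    using f g by (auto simp: V_dom_def)
  have hI: "?h \<in> sym_inv_monoid X" by (rule chart_comp_closed[OF fI gI])
  have dX: "dom ?h \<subseteq> X" by (rule dom_subset_carrier[OF hI])
  have "dom ?h \<notin> F \<or> preserves_filter X F ?h"
  proof (cases "preserves_filter X F f")
    case pf: True
    show ?thesis
    proof (cases "preserves_filter X F g")
      case True
      then show ?thesis using preserves_comp[OF fI pf] by blast
    next
      case False
      then have "dom g \<notin> F" using g by (auto simp: V_dom_def ideal_iff)
      moreover have "chart_image f (dom ?h) \<subseteq> dom g"
        by (auto simp: mem_chart_image chart_comp_eq_Some)
      ultimately have "chart_image f (dom ?h) \<notin> F"
        using upward dom_subset_carrier[OF gI] by blast
      then show ?thesis using pf dX by (simp add: preserves_filter_def)
    qed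
  next
    case False
    then have "dom f \<notin> F" using f by (auto simp: V_dom_def ideal_iff)
    moreover have "dom ?h \<subseteq> dom f" by (auto simp: chart_comp_eq_Some)
    ultimately show ?thesis using upward dom_subset_carrier[OF fI] by blast
  qed
  then show "?h \<in> V_dom X F" using hI dX by (auto simp: V_dom_def ideal_iff)
qed (auto simp: V_dom_def)

lemma stabiliser_subset_V_dom: "filter_stabiliser X F \<subseteq> V_dom X F"
  using stabiliser_subset_monoid by (auto simp: V_dom_def filter_stabiliser_def)

lemma ex_infinite_notin:
  obtains A where "A \<subseteq> X" "infinite A" "A \<notin> F"
proof -
  obtain B where B: "B \<in> F" "B \<subseteq> X" "infinite (X - B)" using split_mem[OF carrier] by blast
  moreover have "X - B \<notin> F" using Diff_mem_iff B by blast
  ultimately show ?thesis using that by blast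
qed

lemma sym_not_subset_V_dom: "\<not> sym_group_on X \<subseteq> V_dom X F"
proof
  assume sub: "sym_group_on X \<subseteq> V_dom X F"
  obtain A where A: "A \<subseteq> X" "infinite A" "A \<notin> F" using ex_infinite_notin by blast
  then have B: "X - A \<in> F" using Diff_mem_iff by blast
  obtain k where k: "bij_betw k A (X - A)"
    using ex_bij_betw_infinite[of A "X - A"] A infinite_mem[OF B] by blast
  \<comment> \<open>A permutation exchanging \<open>A\<close>, outside \<open>F\<close>, with its
    complement, inside \<open>F\<close>. It is total and fails to preserve \<open>F\<close>.\<close>
  define g where "g = (\<lambda>x. if x \<in> A then k x else inv_into A k x)"
  have 1: "bij_betw g A (X - A)"
    by (subst bij_betw_cong[of _ g k]) (auto simp: g_def k)
  have 2: "bij_betw g (X - A) A"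
    by (subst bij_betw_cong[of _ g "inv_into A k"]) (auto simp: g_def bij_betw_inv_into[OF k])
  have "bij_betw g (A \<union> (X - A)) ((X - A) \<union> A)"
    by (intro bij_betw_combine 1 2) auto
  moreover have "A \<union> (X - A) = X" "(X - A) \<union> A = X" using A by auto
  ultimately have "chart_of X g \<in> V_dom X F" using sub chart_of_sym[of g X] by auto
  then have "preserves_filter X F (chart_of X g)"
    using carrier by (simp add: V_dom_def ideal_iff dom_chart_of)
  moreover have "chart_image (chart_of X g) A = g ` A"
    by (rule chart_image_chart_of[OF A(1)])
  then have "chart_image (chart_of X g) A = X - A" using 1 by (simp add: bij_betw_def)
  ultimately show False using A B by (auto simp: preserves_filter_def)
qed

text \<open>
  If \<open>f\<close> maps a member \<open>A\<close> of \<open>F\<close> to a set outside \<open>F\<close>, every chart \<open>h\<close> factors as \<open>v f w\<close> where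
  \<open>v\<close> is total, preserves \<open>F\<close> and has its image in \<open>A\<close>: the domain of \<open>w\<close> can be taken inside
  \<open>A f\<close>, which puts \<open>w\<close> in \<^term>\<open>V_dom X F\<close>.
\<close>

lemma maximal_V_dom: "maximal_subsemigroup_on X (V_dom X F)"
proof -
  have "N = V_dom X F"
    if N: "subsemigroup_on X N" "N \<noteq> sym_inv_monoid X" "V_dom X F \<subseteq> N" for N
  proof (rule ccontr)
    assume "N \<noteq> V_dom X F"
    then obtain f where f: "f \<in> N" "f \<notin> V_dom X F" using N(3) by blast
    have fI: "f \<in> sym_inv_monoid X" by (rule subsemigroup_chart[OF N(1) f(1)])
    obtain A where A: "A \<in> F" "A \<subseteq> dom f" "chart_image f A \<notin> F"
      using not_preserves_witness[OF fI] f(2) fI dom_subset_carrier[OF fI]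
      by (auto simp: V_dom_def ideal_iff)
    obtain v where v: "v \<in> sym_inv_monoid X" "preserves_filter X F v" "dom v = X" "ran v \<subseteq> A"
      using preserving_total_into[OF A(1)] by blast
    have vN: "v \<in> N" using v N(3) by (auto simp: V_dom_def)
    let ?u = "chart_comp v f"
    have uI: "?u \<in> sym_inv_monoid X" by (rule chart_comp_closed[OF v(1) fI])
    have u_total: "\<exists>y. ?u x = Some y" if "x \<in> X" for x
    proof -
      obtain y where y: "v x = Some y" using total_value[OF v(3) \<open>x \<in> X\<close>] by blast
      then have "y \<in> A" using v(4) by (auto simp: ran_def)
      then show ?thesis using y A(2) by (auto simp: chart_comp_eq_Some)
    qed
    have ran_u: "ran ?u \<subseteq> chart_image f A"
      unfolding ran_chart_comp by (rule chart_image_mono[OF v(4)])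
    have AfX: "chart_image f A \<subseteq> X" using chart_in[OF fI] by (auto simp: mem_chart_image)
    have "h \<in> N" if hI: "h \<in> sym_inv_monoid X" for h
    proof -
      \<comment> \<open>As \<open>?u\<close> is total and injective, it cancels against its inverse
        on all of \<open>X\<close>, so \<open>?u\<close> followed by \<open>?w\<close> is
        \<open>h\<close>.\<close>
      let ?w = "chart_comp (chart_inv ?u) h"
      have wI: "?w \<in> sym_inv_monoid X" by (intro chart_comp_closed chart_inv_chart uI hI)
      have "dom ?w \<subseteq> ran ?u"
        by (auto simp: ran_def dom_def chart_comp_eq_Some[of "chart_inv ?u"] chart_inv_eq_Some[OF uI])
      then have "dom ?w \<subseteq> X" "dom ?w \<notin> F" using ran_u A(3) AfX upward by blast+
      then have "?w \<in> N" using N(3) wI by (auto simp: V_dom_def ideal_iff)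
      moreover have "chart_comp ?u ?w = h"
      proof (rule map_eqI)
        fix x z
        show "chart_comp ?u ?w x = Some z \<longleftrightarrow> h x = Some z"
          using u_total chart_in[OF hI, of x z] chart_inj[OF uI]
          by (auto simp: chart_comp_eq_Some[of ?u] chart_comp_eq_Some[of "chart_inv ?u"]
              chart_inv_eq_Some[OF uI]) blast
      qed
      ultimately show ?thesis
        using subsemigroup_comp[OF N(1)] vN f(1) by metis
    qed
    then show False using N(1,2) by (auto simp: subsemigroup_on_def)
  qed
  moreover have "V_dom X F \<noteq> sym_inv_monoid X"
    using sym_not_subset_V_dom by (auto simp: sym_group_on_def)
  ultimately show ?thesis
    using subsemigroup_V_dom by (auto simp: maximal_subsemigroup_on_def)
qed

text \<open>A bijection from an infinite set outside \<open>F\<close> onto \<open>X\<close> has a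
  small domain but a large image, and it cannot preserve \<open>F\<close>.\<close>

lemma V_dom_neq_V_im: "V_dom X F \<noteq> V_im X F"
proof -
  obtain A where A: "A \<subseteq> X" "infinite A" "A \<notin> F" using ex_infinite_notin by blast
  then obtain k where k: "bij_betw k A X" using ex_bij_betw_infinite[of A X] inf by blast
  have c: "chart_of A k \<in> sym_inv_monoid X"
    using k A by (intro chart_of_chart) (auto simp: bij_betw_def)
  then have "chart_of A k \<in> V_dom X F" using A by (simp add: V_dom_def ideal_iff dom_chart_of)
  moreover have "\<not> preserves_filter X F (chart_of A k)"
    using preserves_dom(1)[OF c] A by (auto simp: dom_chart_of)
  then have "chart_of A k \<notin> V_im X F"
    using k carrier by (auto simp: V_im_def ideal_iff ran_chart_of bij_betw_def)
  ultimately show ?thesis by blast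
qed

section \<open>Uniqueness\<close>

text \<open>Multiplying by \<open>u\<close> once more carries the missed points to missed points,
  without collisions, and adds a new one outside \<open>ran u\<close>.\<close>

lemma total_missing:
  assumes M: "subsemigroup_on X M" and u: "u \<in> M" "dom u = X" "ran u \<noteq> X"
  shows "\<exists>w\<in>M. dom w = X \<and> (\<exists>E \<subseteq> X - ran w. finite E \<and> card E = n)"
proof (induction n)
  case 0
  then show ?case using u by (intro bexI[of _ u]) auto
next
  case (Suc n)
  have uI: "u \<in> sym_inv_monoid X" by (rule subsemigroup_chart[OF M u(1)])
  obtain w E where w: "w \<in> M" "dom w = X" "E \<subseteq> X - ran w" "finite E" "card E = n"
    using Suc by blast
  have wI: "w \<in> sym_inv_monoid X" by (rule subsemigroup_chart[OF M w(1)])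
  obtain e where e: "e \<in> X" "e \<notin> ran u" using u(3) ran_subset_carrier[OF uI] by blast
  let ?E = "chart_image u E"
  have E: "?E = (the \<circ> u) ` E" using u(2) w(3) by (intro chart_image_eq_image) auto
  have "inj_on (the \<circ> u) E"
    using bij_betw_chart[OF uI u(2)] w(3) by (auto simp: bij_betw_def intro: inj_on_subset)
  then have "card ?E = n" using w(5) E card_image by metis
  moreover have "e \<notin> ?E" using e(2) by (auto simp: mem_chart_image ran_def)
  moreover have "finite ?E" using w(4) by (rule finite_chart_image)
  ultimately have card: "finite (insert e ?E)" "card (insert e ?E) = Suc n" by auto
  have "insert e ?E \<subseteq> X - ran (chart_comp w u)"
  proof -
    have "y \<notin> ran (chart_comp w u)" if "y \<in> ?E" for y
    proof
      assume "y \<in> ran (chart_comp w u)"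
      then obtain x z where xz: "w x = Some z" "u z = Some y"
        by (auto simp: ran_def chart_comp_eq_Some)
      obtain e where "e \<in> E" "u e = Some y"
        using \<open>y \<in> ?E\<close> by (auto simp: mem_chart_image)
      then have "z \<in> E" using chart_inj[OF uI xz(2)] by blast
      then show False using w(3) xz(1) by (auto simp: ran_def)
    qed
    moreover have "e \<notin> ran (chart_comp w u)"
      using e(2) by (auto simp: ran_def chart_comp_eq_Some)
    moreover have "?E \<subseteq> X" using chart_in[OF uI] by (auto simp: mem_chart_image)
    ultimately show ?thesis using e(1) by blast
  qed
  moreover have "dom (chart_comp w u) = X"
  proof -
    have "\<exists>z. chart_comp w u x = Some z" if "x \<in> X" for x
    proof -
      obtain y where y: "w x = Some y" using total_value[OF w(2) \<open>x \<in> X\<close>] by blast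
      then have "y \<in> dom u" using u(2) chart_in[OF wI] by blast
      then show ?thesis using y by (auto simp: chart_comp_eq_Some)
    qed
    then show ?thesis
      using dom_subset_carrier[OF chart_comp_closed[OF wI uI]] by blast
  qed
  ultimately show ?case
    using subsemigroup_comp[OF M w(1) u(1)] card by blast
qed

text \<open>
  The chart \<open>q\<close> is \<open>p s f\<close> for an \<open>F\<close>-stabilising permutation \<open>s\<close> carrying \<open>E\<close> onto \<open>D\<close>.
\<close>

lemma total_through_stabiliser:
  assumes M: "subsemigroup_on X M" "filter_stabiliser X F \<subseteq> M"
    and p: "p \<in> M" "dom p = X" and f: "f \<in> M"
    and E: "E \<subseteq> X - ran p" "E \<notin> F" and D: "D \<subseteq> X" "D \<notin> F" "X - D \<subseteq> dom f"
    and h: "bij_betw h E D"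
  obtains q where "q \<in> M" "dom q = X" "ran q \<subseteq> chart_image f (X - D)"
proof -
  have pI: "p \<in> sym_inv_monoid X" and fI: "f \<in> sym_inv_monoid X"
    using subsemigroup_chart[OF M(1)] p f by auto
  obtain s where s: "s \<in> filter_stabiliser X F" "\<And>x. x \<in> E \<Longrightarrow> s x = Some (h x)"
    using stabiliser_extend[of E D h] E D h by blast
  have sI: "s \<in> sym_inv_monoid X" and sd: "dom s = X"
    using s(1) by (auto simp: filter_stabiliser_def sym_group_on_def)
  \<comment> \<open>Since \<open>s\<close> is injective and maps \<open>E\<close> onto
    \<open>D\<close>, points off \<open>E\<close> go off \<open>D\<close>; and \<open>p\<close>
    never hits \<open>E\<close>.\<close>
  have avoid: "z \<in> X - D" if "p x = Some y" "s y = Some z" for x y z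
  proof -
    have "y \<notin> E" using that E by (auto simp: ran_def)
    have "z \<notin> D"
    proof
      assume "z \<in> D"
      then obtain e where "e \<in> E" "s e = Some z" using h s(2) by (auto simp: bij_betw_def)
      then show False using \<open>y \<notin> E\<close> that(2) chart_inj[OF sI] by metis
    qed
    then show ?thesis using chart_in[OF sI that(2)] by blast
  qed
  let ?q = "chart_comp (chart_comp p s) f"
  have "?q \<in> M" using subsemigroup_comp[OF M(1)] p f s M(2) by blast
  moreover have "ran ?q \<subseteq> chart_image f (X - D)"
    using avoid by (fastforce simp: ran_def mem_chart_image chart_comp_eq_Some)
  moreover have "\<exists>w. ?q x = Some w" if "x \<in> X" for x
  proof -
    obtain y where y: "p x = Some y" using total_value[OF p(2) \<open>x \<in> X\<close>] by blast
    obtain z where z: "s y = Some z" using sd chart_in[OF pI y] by blast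
    then have "z \<in> dom f" using avoid[OF y z] D(3) by blast
    then show ?thesis using y z by (auto simp: chart_comp_eq_Some)
  qed
  moreover have "dom ?q \<subseteq> X" by (intro dom_subset_carrier chart_comp_closed pI sI fI)
  ultimately show ?thesis using that[of ?q] by blast
qed

text \<open>Finite sets as \<open>J\<close> give a chart \<open>q\<close> in \<open>M\<close> with
  infinitely many missed points, but undefined at finitely many points. The choice
  \<open>J = {{}}\<close> gives a total, non-surjective \<open>u\<close>, whose powers make room to
  repair \<open>q\<close> into a total chart.\<close>

lemma maximal_total_coinfinite:
  assumes M: "maximal_subsemigroup_on X M" "filter_stabiliser X F \<subseteq> M" "\<not> sym_group_on X \<subseteq> M"
  obtains p where "p \<in> M" "dom p = X" "infinite (X - ran p)"
proof -
  have Ms: "subsemigroup_on X M" using M(1) by (simp add: maximal_subsemigroup_on_def)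
  have "subsemigroup_on X (defect_semigroup X {{}})"
    by (rule subsemigroup_defect) (auto simp: chart_image_def)
  then obtain u where u: "u \<in> M" "X - dom u \<in> {{}}" "X - ran u \<notin> {{}}"
    using maximal_not_within_defect[OF M(1,3), of "{{}}"] count inf by auto
  have "subsemigroup_on X (defect_semigroup X (Collect finite))"
    by (rule subsemigroup_defect) (auto simp: finite_chart_image intro: finite_subset)
  then obtain q where q: "q \<in> M" "finite (X - dom q)" "infinite (X - ran q)"
    using maximal_not_within_defect[OF M(1,3), of "Collect finite"] count inf by auto
  have "dom u = X" "ran u \<noteq> X"
    using u dom_subset_carrier[OF subsemigroup_chart[OF Ms u(1)]] by auto
  \<comment> \<open>\<open>E\<close> has as many points as \<open>q\<close> leaves undefined, so a
    stabilising permutation carrying \<open>E\<close> onto \<open>X - dom q\<close> steers the image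
    of \<open>w\<close> into \<open>dom q\<close>.\<close>
  then obtain w E where w: "w \<in> M" "dom w = X" "E \<subseteq> X - ran w" "finite E"
    "card E = card (X - dom q)"
    using total_missing[OF Ms u(1)] by blast
  then obtain h where h: "bij_betw h E (X - dom q)"
    using q(2) finite_same_card_bij by blast
  have "E \<notin> F" "X - dom q \<notin> F" using w q(2) finite_notin by auto
  then obtain p where p: "p \<in> M" "dom p = X" and
    ran_p: "ran p \<subseteq> chart_image q (X - (X - dom q))"
    using total_through_stabiliser[OF Ms M(2) w(1,2) q(1) w(3) _ _ _ _ h] by blast
  note ran_p
  also have "\<dots> \<subseteq> ran q" by (auto simp: mem_chart_image ran_def)
  finally have "X - ran q \<subseteq> X - ran p" by blast
  then have "infinite (X - ran p)" using q(3) by (rule infinite_super)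
  then show ?thesis using that p by blast
qed

text \<open>A chart of \<open>M\<close> outside \<open>V_dom X F\<close> shrinks some member of
  \<open>F\<close> to a set outside \<open>F\<close>. If \<open>ran p\<close> is still in
  \<open>F\<close>, a stabilising permutation first moves it into that member.\<close>

lemma maximal_total_small:
  assumes M: "maximal_subsemigroup_on X M" "filter_stabiliser X F \<subseteq> M" "\<not> sym_group_on X \<subseteq> M"
    and "\<not> M \<subseteq> V_dom X F"
  obtains p where "p \<in> M" "dom p = X" "ran p \<notin> F"
proof -
  have Ms: "subsemigroup_on X M" using M(1) by (simp add: maximal_subsemigroup_on_def)
  obtain p where p: "p \<in> M" "dom p = X" "infinite (X - ran p)"
    using maximal_total_coinfinite[OF M] by blast
  have rp: "ran p \<subseteq> X" by (rule ran_subset_carrier[OF subsemigroup_chart[OF Ms p(1)]])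
  show ?thesis
  proof (cases "ran p \<in> F")
    case False
    then show ?thesis using that p by blast
  next
    case True
    obtain f where f: "f \<in> M" "f \<notin> V_dom X F" using assms(4) by blast
    have fI: "f \<in> sym_inv_monoid X" by (rule subsemigroup_chart[OF Ms f(1)])
    obtain A where A: "A \<in> F" "A \<subseteq> dom f" "chart_image f A \<notin> F"
      using not_preserves_witness[OF fI] f(2) fI dom_subset_carrier[OF fI]
      by (auto simp: V_dom_def ideal_iff)
    \<comment> \<open>Passing from \<open>A\<close> to \<open>B\<close> makes the complement
      infinite, so that it can be matched with \<open>X - ran p\<close>.\<close>
    obtain B where B: "B \<in> F" "B \<subseteq> A" "infinite (A - B)" using split_mem[OF A(1)] by blast
    have BX: "B \<subseteq> X" and AX: "A \<subseteq> X" using A B subset_carrier by auto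
    have "infinite (X - B)" by (rule infinite_super[OF _ B(3)]) (use AX in blast)
    then obtain h where h: "bij_betw h (X - ran p) (X - B)"
      using ex_bij_betw_infinite[of "X - ran p" "X - B"] p(3) by blast
    have XB: "X - (X - B) = B" using BX by blast
    have "X - ran p \<notin> F" "X - B \<notin> F" using True B(1) Diff_mem_iff rp BX by blast+
    moreover have "X - (X - B) \<subseteq> dom f" using XB A(2) B(2) by blast
    ultimately obtain q where q: "q \<in> M" "dom q = X" "ran q \<subseteq> chart_image f (X - (X - B))"
      using total_through_stabiliser[OF Ms M(2) p(1,2) f(1) subset_refl _ Diff_subset _ _ h] by blast
    have "ran q \<subseteq> chart_image f A" using q(3) chart_image_mono[OF B(2)] unfolding XB by blast
    moreover have "chart_image f A \<subseteq> X" using chart_in[OF fI] by (auto simp: mem_chart_image)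
    ultimately have "ran q \<notin> F" using A(3) upward by blast
    then show ?thesis using that q by blast
  qed
qed

text \<open>
  Total charts \<open>p \<in> M\<close> and \<open>q \<in> M\<^sup>-\<^sup>1\<close> with images outside \<open>F\<close> give every permutation \<open>a\<close> as
  \<open>p s q\<^sup>-\<^sup>1\<close>, where \<open>s\<close> stabilises \<open>F\<close> and extends \<open>p\<^sup>-\<^sup>1 a q\<close>.
\<close>

lemma maximal_cases:
  assumes M: "maximal_subsemigroup_on X M" "filter_stabiliser X F \<subseteq> M" "\<not> sym_group_on X \<subseteq> M"
  shows "M = V_dom X F \<or> M = V_im X F"
proof (rule ccontr)
  assume neq: "\<not> (M = V_dom X F \<or> M = V_im X F)"
  have Ms: "subsemigroup_on X M" and Mp: "M \<noteq> sym_inv_monoid X"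
    using M(1) by (auto simp: maximal_subsemigroup_on_def)
  have MI: "M \<subseteq> sym_inv_monoid X" using Ms by (simp add: subsemigroup_on_def)
  let ?M' = "chart_inv ` M"
  have M': "maximal_subsemigroup_on X ?M'" by (rule maximal_inv[OF M(1)])
  have max_eq: "K = L"
    if "maximal_subsemigroup_on X K" "maximal_subsemigroup_on X L" "K \<subseteq> L" for K L
    using that unfolding maximal_subsemigroup_on_def by blast
  have n1: "\<not> M \<subseteq> V_dom X F" using neq max_eq[OF M(1) maximal_V_dom] by blast
  have n2: "\<not> ?M' \<subseteq> V_dom X F"
  proof
    assume "?M' \<subseteq> V_dom X F"
    then have "?M' = V_dom X F" by (rule max_eq[OF M' maximal_V_dom])
    then have "M = V_im X F" using chart_inv_image_image[OF MI] V_im_eq_inv by metis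
    then show False using neq by blast
  qed
  have st': "filter_stabiliser X F \<subseteq> ?M'" using image_mono[OF M(2)] stabiliser_inv by metis
  have "\<not> sym_group_on X \<subseteq> ?M'"
    using image_mono[of "sym_group_on X" ?M' chart_inv] chart_inv_sym[of X]
      chart_inv_image_image[OF MI] M(3) by metis
  \<comment> \<open>Read in \<open>M\<close>, the inverse of \<open>q\<close> is a surjective chart
    with domain outside \<open>F\<close>.\<close>
  then obtain q where q: "q \<in> ?M'" "dom q = X" "ran q \<notin> F"
    using maximal_total_small[OF M' st' _ n2] by blast
  obtain p where p: "p \<in> M" "dom p = X" "ran p \<notin> F"
    using maximal_total_small[OF M n1] by blast
  have pI: "p \<in> sym_inv_monoid X" using p(1) MI by blast
  have qI: "q \<in> sym_inv_monoid X" using q(1) MI chart_inv_chart by blast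
  have q'M: "chart_inv q \<in> M" using q(1) chart_inv_image_image[OF MI] by blast
  have "a \<in> M" if a: "a \<in> sym_group_on X" for a
  proof -
    have aI: "a \<in> sym_inv_monoid X" and ad: "dom a = X" "ran a = X"
      using a by (auto simp: sym_group_on_def)
    let ?p = "the \<circ> p" and ?q = "the \<circ> q" and ?a = "the \<circ> a"
    have bp: "bij_betw ?p X (ran p)" by (rule bij_betw_chart[OF pI p(2)])
    have "bij_betw ?q X (ran q)" by (rule bij_betw_chart[OF qI q(2)])
    moreover have "bij_betw ?a X X" using bij_betw_chart[OF aI ad(1)] ad(2) by simp
    ultimately have "bij_betw (?q \<circ> (?a \<circ> inv_into X ?p)) (ran p) (ran q)"
      using bij_betw_inv_into[OF bp] by (blast intro: bij_betw_trans)
    then obtain s where s: "s \<in> filter_stabiliser X F"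
      "\<And>y. y \<in> ran p \<Longrightarrow> s y = Some ((?q \<circ> (?a \<circ> inv_into X ?p)) y)"
      using stabiliser_extend ran_subset_carrier[OF pI] ran_subset_carrier[OF qI] p(3) q(3) by blast
    let ?r = "chart_comp (chart_comp p s) (chart_inv q)"
    have val: "?r x = a x" if "x \<in> X" for x
    proof -
      obtain y where y: "p x = Some y" using total_value[OF p(2) \<open>x \<in> X\<close>] by blast
      obtain z where z: "a x = Some z" using total_value[OF ad(1) \<open>x \<in> X\<close>] by blast
      obtain w where w: "q z = Some w" using total_value[OF q(2)] chart_in[OF aI z] by blast
      have "inv_into X ?p y = x"
        using inv_into_f_f[of ?p X x] bp that y by (auto simp: bij_betw_def)
      then have "s y = Some w" using s(2)[of y] y z w by (auto simp: ran_def)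
      then have "?r x = Some z"
        using y w by (auto simp: chart_comp_eq_Some chart_inv_eq_Some[OF qI])
      then show ?thesis using z by simp
    qed
    have "?r = a"
    proof
      fix x
      show "?r x = a x"
      proof (cases "x \<in> X")
        case False
        then have "p x = None" "a x = None" using p(2) ad(1) by blast+
        then show ?thesis by (simp add: chart_comp_def map_comp_def)
      qed (rule val)
    qed
    moreover have "?r \<in> M" using subsemigroup_comp[OF Ms] p(1) s(1) M(2) q'M by blast
    ultimately show ?thesis by simp
  qed
  then show False using M(3) by blast
qed

section \<open>Both semigroups satisfy the conditions\<close>

lemma V_dom_conditions:
  "maximal_subsemigroup_on X (V_dom X F) \<and> filter_stabiliser X F \<subseteq> V_dom X F
     \<and> \<not> sym_group_on X \<subseteq> V_dom X F"
  using maximal_V_dom stabiliser_subset_V_dom sym_not_subset_V_dom by blast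

lemma V_im_conditions:
  "maximal_subsemigroup_on X (V_im X F) \<and> filter_stabiliser X F \<subseteq> V_im X F
     \<and> \<not> sym_group_on X \<subseteq> V_im X F"
proof (intro conjI)
  have VI: "V_dom X F \<subseteq> sym_inv_monoid X" by (auto simp: V_dom_def)
  show "maximal_subsemigroup_on X (V_im X F)"
    unfolding V_im_eq_inv by (rule maximal_inv[OF maximal_V_dom])
  show "filter_stabiliser X F \<subseteq> V_im X F"
    using image_mono[OF stabiliser_subset_V_dom] stabiliser_inv V_im_eq_inv by metis
  show "\<not> sym_group_on X \<subseteq> V_im X F"
    using image_mono[of "sym_group_on X" "V_im X F" chart_inv] chart_inv_sym[of X]
      chart_inv_image_image[OF VI] sym_not_subset_V_dom V_im_eq_inv by metis
qed

end

theorem theorem3p40: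
  fixes X :: "'a set" and F :: "'a set set"
  assumes "countable X" and "infinite X"
    and "ultrafilter_on X F" and "\<not> principal_ultrafilter_on X F"
  shows "{M. maximal_subsemigroup_on X M \<and> filter_stabiliser X F \<subseteq> M \<and> \<not> sym_group_on X \<subseteq> M}
           = {V_dom X F, V_im X F}
         \<and> V_dom X F \<noteq> V_im X F"
proof -
  interpret nonprincipal_ultrafilter X F
    using assms by unfold_locales
  show ?thesis
    using maximal_cases V_dom_conditions V_im_conditions V_dom_neq_V_im by blast
qed

end
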